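(* Let $K_1,\dots,K_n$ be convex bodies in $\mathbb{R}^n$ of class $C^2_+$ with centroid at the origin, and let $p,r$ be real numbers. (i) If $-n<r<p$ or $r<p<-n$, then $$\left(\frac{as_p(K_1,\dots,K_n)}{n\tilde V(K_1^\circ,\dots,K_n^\circ)}\right)^{n+p}\le\left(\frac{as_r(K_1,\dots,K_n)}{n\tilde V(K_1^\circ,\dots,K_n^\circ)}\right)^{n+r}.$$ (ii) If $0<p<r$, or $p<r<-n$, or $r<-n<0<p$, or $-n<p<r<0$, then $$\left(\frac{as_p(K_1,\dots,K_n)}{as_0(K_1,\dots,K_n)}\right)^{\frac{n+p}{p}}\le\left(\frac{as_r(K_1,\dots,K_n)}{as_0(K_1,\dots,K_n)}\right)^{\frac{n+r}{r}}.$$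
   Context: $K\in C^2_+$ means that $\partial K$ is of class $C^2$ with everywhere strictly positive Gauss curvature. $h_K$ is the support function of $K$; $f_K(u)$ is the reciprocal of the Gauss curvature of $\partial K$ at the unique boundary point with outer unit normal $u\in S^{n-1}$; $\sigma$ is the surface area measure on $S^{n-1}$. For real $p\ne-n$, $$as_p(K_1,\dots,K_n)=\int_{S^{n-1}}\big[h_{K_1}(u)^{1-p}f_{K_1}(u)\cdots h_{K_n}(u)^{1-p}f_{K_n}(u)\big]^{\frac1{n+p}}\,d\sigma(u).$$ $K^\circ$ is the polar body of $K$, and $\tilde V(K_1^\circ,\dots,K_n^\circ)=\frac1n\int_{S^{n-1}}\frac{1}{h_{K_1}(u)\cdots h_{K_n}(u)}\,d\sigma(u)$ is the dual mixed volume of the polars. *)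

theory Defs
  imports "HOL-Analysis.Analysis"
begin

definition convex_body :: "(real ^ 'n) set \<Rightarrow> bool" where
  "convex_body K \<longleftrightarrow> compact K \<and> convex K \<and> interior K \<noteq> {}"

definition centroid :: "(real ^ 'n) set \<Rightarrow> real ^ 'n" where
  "centroid K = (1 / measure lborel K) *\<^sub>R (LINT x:K|lborel. x)"

definition support_fun :: "(real ^ 'n) set \<Rightarrow> real ^ 'n \<Rightarrow> real" where
  "support_fun K u = (SUP x\<in>K. x \<bullet> u)"

definition polar_body :: "(real ^ 'n) set \<Rightarrow> (real ^ 'n) set" where
  "polar_body K = {y. \<forall>x\<in>K. x \<bullet> y \<le> 1}"

definition radial_fun :: "(real ^ 'n) set \<Rightarrow> real ^ 'n \<Rightarrow> real" where
  "radial_fun L u = Sup {t. 0 \<le> t \<and> t *\<^sub>R u \<in> L}"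

definition outer_unit_normal :: "(real ^ 'n) set \<Rightarrow> real ^ 'n \<Rightarrow> real ^ 'n \<Rightarrow> bool" where
  "outer_unit_normal K x u \<longleftrightarrow> x \<in> frontier K \<and> norm u = 1 \<and> (\<forall>y\<in>K. (y - x) \<bullet> u \<le> 0)"

text \<open>Only meaningful where the outer unit normal is unique, as it is when the boundary
  is of class $C^2$.\<close>

definition gauss_map :: "(real ^ 'n) set \<Rightarrow> real ^ 'n \<Rightarrow> real ^ 'n" where
  "gauss_map K x = (THE u. outer_unit_normal K x u)"

definition C2_on :: "(real ^ 'n) set \<Rightarrow> (real ^ 'n \<Rightarrow> real) \<Rightarrow> bool" where
  "C2_on U g \<longleftrightarrow> (\<exists>(G :: real ^ 'n \<Rightarrow> real ^ 'n) (H :: real ^ 'n \<Rightarrow> real ^ 'n ^ 'n).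
     (\<forall>y\<in>U. (g has_derivative (\<lambda>v. G y \<bullet> v)) (at y)) \<and>
     (\<forall>y\<in>U. (G has_derivative (\<lambda>v. H y *v v)) (at y)) \<and>
     continuous_on U H)"

text \<open>Embedded hypersurface of class $C^2$: locally a regular level set.\<close>

definition C2_hypersurface :: "(real ^ 'n) set \<Rightarrow> bool" where
  "C2_hypersurface S \<longleftrightarrow> (\<forall>x\<in>S. \<exists>U g. open U \<and> x \<in> U \<and> C2_on U g \<and>
     (\<forall>y\<in>U. \<not> (g has_derivative (\<lambda>v. 0)) (at y)) \<and> S \<inter> U = {y \<in> U. g y = 0})"

text \<open>The Gauss curvature at \<open>x\<close> is the determinant of the Weingarten map, i.e. of the
  differential of the Gauss map on the tangent space \<open>T\<close>, which is the orthogonal complement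
  of the normal \<open>u\<close>.  The differential within the boundary is determined only on \<open>T\<close>, so it
  is composed with the orthogonal projection onto \<open>T\<close>; it maps \<open>T\<close> to itself, and extending
  it by the identity on the normal line leaves the determinant unchanged.\<close>

definition gauss_curvature :: "(real ^ 'n) set \<Rightarrow> real ^ 'n \<Rightarrow> real" where
  "gauss_curvature K x =
     (let u = gauss_map K x;
          W = frechet_derivative (gauss_map K) (at x within frontier K)
      in det (matrix (\<lambda>v. W (v - (v \<bullet> u) *\<^sub>R u) + (v \<bullet> u) *\<^sub>R u)))"

definition C2_plus :: "(real ^ 'n) set \<Rightarrow> bool" where
  "C2_plus K \<longleftrightarrow> C2_hypersurface (frontier K) \<and> (\<forall>x\<in>frontier K. 0 < gauss_curvature K x)"

definition curvature_fun :: "(real ^ 'n) set \<Rightarrow> real ^ 'n \<Rightarrow> real" where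
  "curvature_fun K u = 1 / gauss_curvature K (THE x. outer_unit_normal K x u)"

text \<open>The polar-coordinate construction: \<open>A\<close> has measure \<open>n\<close> times the volume of the cone
  of all \<open>x\<close> with \<open>0 < norm x < 1\<close> and \<open>x / norm x \<in> A\<close>.\<close>

definition sphere_measure :: "(real ^ 'n) measure" where
  "sphere_measure = scale_measure (of_nat CARD('n))
     (distr (restrict_space lborel (ball 0 1 - {0})) (restrict_space borel (sphere 0 1)) sgn)"

lemma space_sphere_measure [simp]: "space (sphere_measure :: (real ^ 'n) measure) = sphere 0 1"
  by (simp add: sphere_measure_def space_scale_measure space_restrict_space)

lemma sets_sphere_measure [measurable_cong]:
  "sets (sphere_measure :: (real ^ 'n) measure) = sets (restrict_space borel (sphere 0 1))"
  by (simp add: sphere_measure_def)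

lemma emeasure_sphere_measure:
  fixes A :: "(real ^ 'n) set"
  assumes "A \<in> sets sphere_measure"
  shows "emeasure sphere_measure A =
           of_nat CARD('n) * emeasure lborel {x. 0 < norm x \<and> norm x < 1 \<and> sgn x \<in> A}"
proof -
  let ?B = "ball (0 :: real ^ 'n) 1 - {0}"
  have A: "A \<in> sets (restrict_space borel (sphere 0 1))"
    using assms by (simp add: sets_sphere_measure)
  have "sgn \<in> restrict_space lborel ?B \<rightarrow>\<^sub>M (borel :: (real ^ 'n) measure)"
    unfolding sgn_div_norm by (intro measurable_restrict_space1) measurable
  then have m: "sgn \<in> restrict_space lborel ?B \<rightarrow>\<^sub>M restrict_space borel (sphere 0 1)"
    by (intro measurable_restrict_space2) (auto simp: space_restrict_space norm_sgn)
  have "?B \<inter> sgn -` A = {x. 0 < norm x \<and> norm x < 1 \<and> sgn x \<in> A}"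
    by auto
  moreover have "sgn -` A \<inter> space (restrict_space lborel ?B) = ?B \<inter> sgn -` A"
    by (auto simp: space_restrict_space)
  moreover have "emeasure (restrict_space lborel ?B) (?B \<inter> sgn -` A) = emeasure lborel (?B \<inter> sgn -` A)"
    by (rule emeasure_restrict_space) auto
  ultimately show ?thesis
    using A m
    by (simp add: sphere_measure_def emeasure_scale_measure emeasure_distr)
qed

text \<open>A family of \<open>n\<close> bodies in \<open>n\<close>-space is indexed by the coordinate type \<open>'n\<close>.\<close>

definition mixed_affine_surface_area :: "real \<Rightarrow> ('n \<Rightarrow> (real ^ 'n) set) \<Rightarrow> real" where
  "mixed_affine_surface_area p K =
     (LINT u|sphere_measure.
        (\<Prod>i\<in>UNIV. support_fun (K i) u powr (1 - p) * curvature_fun (K i) u)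
          powr (1 / (real CARD('n) + p)))"

definition dual_mixed_volume :: "('n \<Rightarrow> (real ^ 'n) set) \<Rightarrow> real" where
  "dual_mixed_volume L =
     1 / real CARD('n) * (LINT u|sphere_measure. (\<Prod>i\<in>UNIV. radial_fun (L i) u))"

lemma support_fun_pos:
  fixes K :: "(real ^ 'n) set"
  assumes K: "compact K" and 0: "0 \<in> interior K" and u: "norm u = 1"
  shows "0 < support_fun K u"
proof -
  obtain e where e: "e > 0" "cball 0 e \<subseteq> K"
    using 0 by (auto simp: mem_interior_cball)
  have "e *\<^sub>R u \<in> K" using e u by (auto simp: subset_iff)
  moreover have "bdd_above ((\<lambda>x. x \<bullet> u) ` K)"
    by (intro bounded_imp_bdd_above compact_imp_bounded compact_continuous_image K continuous_intros)
  ultimately have "(e *\<^sub>R u) \<bullet> u \<le> support_fun K u"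
    unfolding support_fun_def by (rule cSUP_upper)
  then show ?thesis using e u by (simp add: dot_square_norm)
qed

lemma radial_fun_polar_body:
  fixes K :: "(real ^ 'n) set"
  assumes K: "compact K" and 0: "0 \<in> interior K" and u: "norm u = 1"
  shows "radial_fun (polar_body K) u = 1 / support_fun K u"
proof -
  have h: "0 < support_fun K u" by (rule support_fun_pos[OF assms])
  have ne: "K \<noteq> {}" using 0 interior_subset by blast
  have bdd: "bdd_above ((\<lambda>x. x \<bullet> u) ` K)"
    by (intro bounded_imp_bdd_above compact_imp_bounded compact_continuous_image K continuous_intros)
  have "t *\<^sub>R u \<in> polar_body K \<longleftrightarrow> t \<le> 1 / support_fun K u" if t: "0 \<le> t" for t
  proof (cases "t = 0")
    case True
    then show ?thesis using h by (simp add: polar_body_def)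
  next
    case False
    with t have t: "0 < t" by simp
    have "t *\<^sub>R u \<in> polar_body K \<longleftrightarrow> (\<forall>x\<in>K. x \<bullet> u \<le> 1 / t)"
      using t by (simp add: polar_body_def field_simps)
    also have "\<dots> \<longleftrightarrow> support_fun K u \<le> 1 / t"
      unfolding support_fun_def using cSUP_le_iff[OF ne bdd] by simp
    also have "\<dots> \<longleftrightarrow> t \<le> 1 / support_fun K u"
      using t h by (simp add: field_simps)
    finally show ?thesis .
  qed
  then have "{t. 0 \<le> t \<and> t *\<^sub>R u \<in> polar_body K} = {0..1 / support_fun K u}"
    by auto
  then show ?thesis using h by (simp add: radial_fun_def)
qed

lemma dual_mixed_volume_polar:
  fixes K :: "'n \<Rightarrow> (real ^ 'n) set"
  assumes "\<And>i. compact (K i)" "\<And>i. 0 \<in> interior (K i)"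
  shows "dual_mixed_volume (\<lambda>i. polar_body (K i)) =
     1 / real CARD('n) * (LINT u|sphere_measure. 1 / (\<Prod>i\<in>UNIV. support_fun (K i) u))"
proof -
  have "(\<Prod>i\<in>UNIV. radial_fun (polar_body (K i)) u) = 1 / (\<Prod>i\<in>UNIV. support_fun (K i) u)"
    if "norm u = 1" for u
    using that by (simp add: radial_fun_polar_body assms prod_dividef)
  then show ?thesis
    unfolding dual_mixed_volume_def
    by (intro arg_cong2[where f = "(*)"] refl Bochner_Integration.integral_cong) auto
qed

end

theory Submission
  imports Defs
begin

text \<open>Write \<open>h\<close> and \<open>f\<close> for the products of the support functions and of the curvature functions,
  and put \<open>g = h ^ (n + 1) * f\<close>.  Then \<open>as_p\<close> is the integral of \<open>g powr (1 / (n + p))\<close> against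
  \<open>1 / h\<close>, whose total mass is \<open>n\<close> times the dual mixed volume, so (i) compares two power means with
  exponents \<open>1 / (n + p)\<close> and \<open>1 / (n + r)\<close>.  It is also the integral of
  \<open>(g powr (- 1 / n)) powr (p / (n + p))\<close> against \<open>(h * f) powr (1 / n)\<close>, whose total mass is
  \<open>as_0\<close>, so (ii) compares power means with exponents \<open>p / (n + p)\<close> and \<open>r / (n + r)\<close>.  In every
  case the two exponents have the same sign.

  All integrals converge because \<open>h\<close> and \<open>f\<close> are continuous and positive on the sphere.  For
  \<open>h\<close> this needs the origin in the interior, which the centroid condition provides.  For \<open>f\<close>
  it needs the curvature to be continuous on the boundary and the Gauss map to be a homeomorphism
  onto the sphere; both the Gauss map and its inverse have a closed graph, and hence are
  continuous, by compactness.\<close>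

section \<open>Power means\<close>

text \<open>Bernoulli's inequality for real exponents: a convex power lies above its tangent line at
  1.\<close>

lemma powr_ge_tangent:
  fixes t q :: real
  assumes "0 < t" "1 \<le> q"
  shows "1 + q * (t - 1) \<le> t powr q"
proof -
  have "((\<lambda>x. x powr q) has_real_derivative q * 1 powr (q - 1)) (at 1)"
    by (rule has_real_derivative_powr) simp
  then have "t powr q - 1 powr q \<ge> (q * 1 powr (q - 1)) * (t - 1)"
    using assms
    by (intro convex_on_imp_above_tangent[OF powr_convex[OF assms(2)]])
      (auto intro: has_field_derivative_at_within simp: interior_open)
  then show ?thesis by simp
qed

text \<open>Integrating \<open>powr_ge_tangent\<close> at \<open>t = f x / m\<close> for the weighted mean \<open>m\<close> of \<open>f\<close>.\<close>

lemma weighted_mean_powr_le: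
  fixes f w :: "'a \<Rightarrow> real"
  assumes w: "integrable M w" and f: "integrable M (\<lambda>x. w x * f x)"
    and fq: "integrable M (\<lambda>x. w x * f x powr q)"
    and pos: "\<And>x. x \<in> space M \<Longrightarrow> 0 < w x" "\<And>x. x \<in> space M \<Longrightarrow> 0 < f x"
    and q: "1 \<le> q" and W: "0 < (LINT x|M. w x)" and F: "0 < (LINT x|M. w x * f x)"
  shows "((LINT x|M. w x * f x) / (LINT x|M. w x)) powr q \<le> (LINT x|M. w x * f x powr q) / (LINT x|M. w x)"
proof -
  let ?W = "LINT x|M. w x" and ?F = "LINT x|M. w x * f x"
  define m where "m = ?F / ?W"
  have m: "m > 0" using W F by (simp add: m_def)
  \<comment> \<open>The right side integrates the tangent line against \<open>w\<close>. Its sloped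
    part \<open>q * (f x / m - 1)\<close> contributes zero because \<open>m\<close> is the weighted
    mean of \<open>f\<close>.\<close>
  have "m powr q * ?W = (LINT x|M. m powr q * ((1 - q) * w x + (q / m) * (w x * f x)))"
  proof -
    have "(LINT x|M. m powr q * ((1 - q) * w x + (q / m) * (w x * f x)))
        = m powr q * ((1 - q) * ?W + (q / m) * ?F)"
      using w f by simp
    also have "(q / m) * ?F = q * ?W" using F W by (simp add: m_def)
    finally show ?thesis by (simp add: algebra_simps)
  qed
  also have "\<dots> \<le> (LINT x|M. w x * f x powr q)"
  proof (rule integral_mono)
    fix x assume x: "x \<in> space M"
    have "m powr q * (1 + q * (f x / m - 1)) \<le> m powr q * (f x / m) powr q"
      using pos(2)[OF x] m q by (intro mult_left_mono powr_ge_tangent) auto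
    also have "\<dots> = f x powr q" using pos(2)[OF x] m by (simp add: powr_divide)
    finally have "w x * (m powr q * (1 + q * (f x / m - 1))) \<le> w x * f x powr q"
      using pos(1)[OF x] by (intro mult_left_mono) auto
    moreover have "w x * (m powr q * (1 + q * (f x / m - 1)))
        = m powr q * ((1 - q) * w x + (q / m) * (w x * f x))"
      by (simp add: algebra_simps)
    ultimately show "m powr q * ((1 - q) * w x + (q / m) * (w x * f x)) \<le> w x * f x powr q" by simp
  qed (use w f fq in auto)
  finally show ?thesis using W by (simp add: m_def field_simps)
qed

text \<open>Jensen's inequality for \<open>f powr c\<close> and an exponent \<open>q \<ge> 1\<close>
  compares two moments of \<open>f\<close>; taking roots then compares the means. Exponents of equal
  sign suffice, so no geometric mean enters as a limiting case.\<close>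

lemma weighted_power_mean_mono:
  fixes f w :: "'a \<Rightarrow> real"
  assumes int: "\<And>c. integrable M (\<lambda>x. w x * f x powr c)"
    and intpos: "\<And>c. 0 < (LINT x|M. w x * f x powr c)"
    and pos: "\<And>x. x \<in> space M \<Longrightarrow> 0 < w x" "\<And>x. x \<in> space M \<Longrightarrow> 0 < f x"
    and ab: "a \<le> b" "0 < a * b"
  shows "((LINT x|M. w x * f x powr a) / (LINT x|M. w x)) powr (1 / a)
       \<le> ((LINT x|M. w x * f x powr b) / (LINT x|M. w x)) powr (1 / b)"
proof -
  have w: "integrable M w" "0 < (LINT x|M. w x)"
  proof -
    \<comment> \<open>The case \<open>c = 0\<close> isolates the weight. Positivity of
      \<open>f x\<close> matters, since \<open>0 powr 0 = 0\<close>.\<close>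
    have "w x * f x powr 0 = w x" if "x \<in> space M" for x using pos(2)[OF that] by simp
    then show "integrable M w" "0 < (LINT x|M. w x)"
      using int[of 0] intpos[of 0] Bochner_Integration.integrable_cong[OF refl, of M "\<lambda>x. w x * f x powr 0" w]
        Bochner_Integration.integral_cong[OF refl, of M "\<lambda>x. w x * f x powr 0" w]
      by metis+
  qed
  define A where "A c = (LINT x|M. w x * f x powr c) / (LINT x|M. w x)" for c
  have A: "A c > 0" for c using w intpos by (simp add: A_def)
  have key: "A c powr q \<le> A (c * q)" if "q \<ge> 1" for c q
    unfolding A_def
    using weighted_mean_powr_le[of M w "\<lambda>x. f x powr c" q, unfolded powr_powr] int intpos w pos that
    by (simp add: order.strict_implies_not_eq[THEN not_sym])
  consider "0 < a" "0 < b" | "a < 0" "b < 0"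
    using ab by (auto simp: zero_less_mult_iff)
  then have "A a powr (1 / a) \<le> A b powr (1 / b)"
  proof cases
    case 1
    have "A a powr (1 / a) = (A a powr (b / a)) powr (1 / b)" using 1 by (simp add: powr_powr)
    also have "\<dots> \<le> A b powr (1 / b)"
      using key[of "b / a" a] 1 ab by (intro powr_mono2) auto
    finally show ?thesis .
  next
    case 2
    \<comment> \<open>For negative exponents it is \<open>a / b\<close> that is at least 1, so the
      roles of \<open>a\<close> and \<open>b\<close> in \<open>key\<close> swap; the negative outer
      exponent \<open>1 / a\<close> reverses the inequality back.\<close>
    have "A a powr (1 / a) \<le> (A b powr (a / b)) powr (1 / a)"
      using key[of "a / b" b] 2 ab A[of b] by (intro powr_mono2') (auto simp: field_simps)
    also have "\<dots> = A b powr (1 / b)" using 2 by (simp add: powr_powr)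
    finally show ?thesis .
  qed
  then show ?thesis by (simp add: A_def)
qed

section \<open>Tangent vectors and normals\<close>

text \<open>The adjacent tangent cone: \<open>S\<close> must come within o(s) of
  \<open>x + s *\<^sub>R t\<close> for every small positive \<open>s\<close>, not just along some
  sequence. It is one-sided, so \<open>t\<close> may be tangent without \<open>- t\<close>, as at
  the end of a segment.\<close>

definition tangent_within :: "'a::real_normed_vector set \<Rightarrow> 'a \<Rightarrow> 'a \<Rightarrow> bool" where
  "tangent_within S x t \<longleftrightarrow>
     (\<forall>e>0. \<exists>d>0. \<forall>s. 0 < s \<and> s < d \<longrightarrow> (\<exists>y\<in>S. norm (y - x - s *\<^sub>R t) \<le> e * s))"

lemma tangent_within_subset:
  assumes "tangent_within S x t" "S \<subseteq> T"
  shows "tangent_within T x t"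
  using assms unfolding tangent_within_def by (meson subsetD)

lemma tangent_within_segment:
  assumes "closed_segment x y \<subseteq> S"
  shows "tangent_within S x (y - x)"
proof -
  have "x + s *\<^sub>R (y - x) \<in> S" if "0 < s" "s < 1" for s :: real
  proof -
    have "x + s *\<^sub>R (y - x) = (1 - s) *\<^sub>R x + s *\<^sub>R y" by (simp add: algebra_simps)
    then have "x + s *\<^sub>R (y - x) \<in> closed_segment x y" unfolding in_segment using that by (intro exI[of _ s]) simp
    then show ?thesis using assms by blast
  qed
  then have "\<exists>z\<in>S. norm (z - x - s *\<^sub>R (y - x)) \<le> e * s" if "0 < e" "0 < s" "s < 1" for e s :: real
    using that by (intro bexI[of _ "x + s *\<^sub>R (y - x)"]) auto
  then show ?thesis
    unfolding tangent_within_def by (meson zero_less_one)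
qed

text \<open>The intermediate value theorem along the normal line replaces the implicit function
  theorem.\<close>

lemma tangent_within_level_set:
  fixes g :: "'a::real_inner \<Rightarrow> real"
  assumes U: "open U" "x \<in> U" and cont: "continuous_on U g" and gx: "g x = 0"
    and der: "(g has_derivative (\<lambda>v. c \<bullet> v)) (at x)" and c: "c \<noteq> 0" and t: "c \<bullet> t = 0"
  shows "tangent_within {y \<in> U. g y = 0} x t"
  unfolding tangent_within_def
proof (intro allI impI)
  fix e :: real assume e: "0 < e"
  \<comment> \<open>With this bound on the coefficient of \<open>c\<close>, the correction along the
    normal has length at most \<open>e\<close> per unit of \<open>s\<close>.\<close>
  define b where "b = e / norm c"
  have b: "b > 0" using e c by (simp add: b_def)
  \<comment> \<open>Tilting \<open>t\<close> towards \<open>c\<close> by a coefficient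
    \<open>k\<close> gives a directional derivative with the sign of \<open>k\<close>, so
    \<open>k = b\<close> and \<open>k = - b\<close> bracket a zero of \<open>g\<close>.\<close>
  have D: "((\<lambda>s. g (x + s *\<^sub>R (t + k *\<^sub>R c))) has_real_derivative k * (c \<bullet> c)) (at 0)" for k
  proof -
    have "((\<lambda>s. g (x + s *\<^sub>R (t + k *\<^sub>R c))) has_derivative (\<lambda>s. c \<bullet> (s *\<^sub>R (t + k *\<^sub>R c)))) (at 0)"
      by (rule has_derivative_compose[where g=g and f="\<lambda>s. x + s *\<^sub>R (t + k *\<^sub>R c)" and s=UNIV])
        (auto intro!: derivative_eq_intros simp: der)
    moreover have "(\<lambda>s. c \<bullet> (s *\<^sub>R (t + k *\<^sub>R c))) = (*) (k * (c \<bullet> c))"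
      by (simp add: fun_eq_iff inner_right_distrib t)
    ultimately show ?thesis by (simp add: has_field_derivative_def)
  qed
  have cc: "c \<bullet> c > 0" using c by simp
  obtain d1 where d1: "d1 > 0" "\<And>s. 0 < s \<Longrightarrow> s < d1 \<Longrightarrow> 0 < g (x + s *\<^sub>R (t + b *\<^sub>R c))"
    using has_real_derivative_pos_inc_right[OF D[of b]] b cc gx by auto
  obtain d2 where d2: "d2 > 0" "\<And>s. 0 < s \<Longrightarrow> s < d2 \<Longrightarrow> g (x + s *\<^sub>R (t + (- b) *\<^sub>R c)) < 0"
    using has_real_derivative_neg_dec_right[OF D[of "-b"]] b cc gx by auto
  obtain r where r: "r > 0" "ball x r \<subseteq> U" using U openE by blast
  \<comment> \<open>Below this bound on \<open>s\<close>, all the tilted points with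
    \<open>\<bar>k\<bar> \<le> b\<close> remain in the ball of radius \<open>r\<close>, hence in
    \<open>U\<close>.\<close>
  define d3 where "d3 = r / (norm t + e + 1)"
  have nt: "norm t + e + 1 > 0" using e norm_ge_zero[of t] by linarith
  have d3: "d3 > 0" using r nt by (simp add: d3_def)
  show "\<exists>d>0. \<forall>s. 0 < s \<and> s < d \<longrightarrow> (\<exists>y\<in>{y \<in> U. g y = 0}. norm (y - x - s *\<^sub>R t) \<le> e * s)"
  proof (intro exI[of _ "min d1 (min d2 d3)"] conjI allI impI)
    fix s :: real assume s: "0 < s \<and> s < min d1 (min d2 d3)"
    have inU: "x + s *\<^sub>R (t + k *\<^sub>R c) \<in> U" if "\<bar>k\<bar> \<le> b" for k
    proof -
      have "norm (t + k *\<^sub>R c) \<le> norm t + \<bar>k\<bar> * norm c"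
        by (metis norm_scaleR norm_triangle_ineq)
      also have "\<bar>k\<bar> * norm c \<le> b * norm c" using that by (intro mult_right_mono) auto
      also have "b * norm c = e" using c by (simp add: b_def)
      finally have "s * norm (t + k *\<^sub>R c) \<le> s * (norm t + e)" using s by (intro mult_left_mono) auto
      also have "\<dots> < s * (norm t + e + 1)" using s by simp
      also have "\<dots> < r" using s nt by (simp add: d3_def field_simps)
      finally show ?thesis using r s by (intro subsetD[OF r(2)]) (simp add: dist_norm)
    qed
    have "\<exists>k\<ge>-b. k \<le> b \<and> g (x + s *\<^sub>R (t + k *\<^sub>R c)) = 0"
    proof (rule IVT')
      show "continuous_on {-b..b} (\<lambda>k. g (x + s *\<^sub>R (t + k *\<^sub>R c)))"
        using inU by (intro continuous_on_compose2[OF cont] continuous_intros) auto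
    qed (use d1 d2 s b in \<open>auto intro!: less_imp_le\<close>)
    then obtain k where k: "\<bar>k\<bar> \<le> b" "g (x + s *\<^sub>R (t + k *\<^sub>R c)) = 0"
      by (meson abs_le_iff minus_le_iff)
    have "norm ((x + s *\<^sub>R (t + k *\<^sub>R c)) - x - s *\<^sub>R t) = s * (\<bar>k\<bar> * norm c)"
      using s by (simp add: algebra_simps abs_mult)
    also have "\<dots> \<le> s * (b * norm c)" using s k by (intro mult_left_mono mult_right_mono) auto
    also have "\<dots> = e * s" using c by (simp add: b_def)
    finally show "\<exists>y\<in>{y \<in> U. g y = 0}. norm (y - x - s *\<^sub>R t) \<le> e * s"
      using inU[OF k(1)] k(2) by blast
  qed (use d1 d2 d3 in auto)
qed

text \<open>A derivative within a thin set is not unique, but it is along tangent directions: the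
  difference \<open>E\<close> of two derivatives is o(norm (y - x)) on \<open>S\<close>, and points
  of \<open>S\<close> approximate \<open>x + s *\<^sub>R t\<close> up to o(s), which forces
  \<open>E t = 0\<close>.\<close>

lemma has_derivative_unique_tangent:
  assumes f: "(f has_derivative D) (at x within S)" "(f has_derivative D') (at x within S)"
    and t: "tangent_within S x t"
  shows "D t = D' t"
proof -
  define E where "E = (\<lambda>v. D v - D' v)"
  have E: "((\<lambda>_. 0) has_derivative E) (at x within S)"
    using has_derivative_diff[OF f] by (simp add: E_def)
  then have bl: "bounded_linear E" by (rule has_derivative_bounded_linear)
  from bounded_linear.pos_bounded[OF bl]
  obtain B where B: "B > 0" "\<And>v. norm (E v) \<le> norm v * B" by blast
  have "norm (E t) \<le> 0 + e" if e: "e > 0" for e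
  proof -
    \<comment> \<open>One accuracy \<open>a\<close> serves both estimates; the errors below add up
      to \<open>a * (norm t + 1 + B)\<close>, which this choice bounds by \<open>e\<close>.\<close>
    define a where "a = min 1 (e / (norm t + 1 + B))"
    have pos: "norm t + 1 + B > 0" using B(1) norm_ge_zero[of t] by linarith
    have a: "a > 0" "a \<le> 1" using e pos by (simp_all add: a_def)
    have "a \<le> e / (norm t + 1 + B)" by (simp add: a_def)
    then have ae: "a * (norm t + 1 + B) \<le> e" using pos by (simp only: pos_le_divide_eq)
    obtain d where d: "d > 0" "\<And>y. y \<in> S \<Longrightarrow> norm (y - x) < d \<Longrightarrow> norm (E (y - x)) \<le> a * norm (y - x)"
    proof -
      have "\<exists>d>0. \<forall>y\<in>S. norm (y - x) < d \<longrightarrow> norm (E (y - x)) \<le> a * norm (y - x)"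
        using E a(1) by (simp add: has_derivative_within_alt)
      then show ?thesis using that by blast
    qed
    obtain d' where d': "d' > 0" "\<And>s. 0 < s \<Longrightarrow> s < d' \<Longrightarrow> \<exists>y\<in>S. norm (y - x - s *\<^sub>R t) \<le> a * s"
      using t a(1) unfolding tangent_within_def by meson
    define s where "s = min (d' / 2) (d / (2 * (norm t + 1)))"
    have nt: "norm t + 1 > 0" by (simp add: add_nonneg_pos)
    have s: "0 < s" "s < d'" "s * (norm t + 1) < d"
    proof -
      show "0 < s" "s < d'" using d d' nt by (auto simp: s_def)
      have "s * (norm t + 1) \<le> d / (2 * (norm t + 1)) * (norm t + 1)"
        using nt by (intro mult_right_mono) (auto simp: s_def)
      also have "\<dots> = d / 2" using nt by (simp add: field_simps)
      finally show "s * (norm t + 1) < d" using d by simp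
    qed
    obtain y where y: "y \<in> S" "norm (y - x - s *\<^sub>R t) \<le> a * s" using d' s by blast
    have "norm (y - x) \<le> norm (s *\<^sub>R t) + norm (y - x - s *\<^sub>R t)"
      by (rule norm_triangle_sub)
    also have "\<dots> \<le> s * norm t + a * s" using y s by simp
    also have "\<dots> \<le> s * (norm t + 1)" using mult_right_mono[OF a(2), of s] s by (simp add: distrib_left)
    finally have yx: "norm (y - x) \<le> s * (norm t + 1)" .
    have "s * norm (E t) = norm (E (s *\<^sub>R t))"
      using linear_cmul[OF bounded_linear.linear[OF bl], of s t] s by simp
    also have "E (s *\<^sub>R t) = E (y - x) - E (y - x - s *\<^sub>R t)"
      using linear_diff[OF bounded_linear.linear[OF bl], of "y - x" "s *\<^sub>R t"] by simp
    also have "norm \<dots> \<le> norm (E (y - x)) + norm (E (y - x - s *\<^sub>R t))" by (rule norm_triangle_ineq4)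
    also have "norm (E (y - x)) \<le> a * norm (y - x)" using d(2)[OF y(1)] yx s(3) by simp
    also have "\<dots> \<le> a * (s * (norm t + 1))" using a yx by (intro mult_left_mono) auto
    also have "norm (E (y - x - s *\<^sub>R t)) \<le> norm (y - x - s *\<^sub>R t) * B" by (rule B)
    also have "\<dots> \<le> a * s * B" using y(2) B(1) by (intro mult_right_mono) auto
    finally have "s * norm (E t) \<le> s * (a * (norm t + 1 + B))" by (simp add: algebra_simps)
    then have "norm (E t) \<le> a * (norm t + 1 + B)" using s by simp
    then show ?thesis using ae by simp
  qed
  then have "norm (E t) \<le> 0" by (rule field_le_epsilon)
  then show ?thesis by (simp add: E_def)
qed

section \<open>Existence, uniqueness and continuity of the outer unit normal\<close>

text \<open>The supporting inequality holds at boundary points near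
  \<open>x + s *\<^sub>R t\<close>; dividing it by \<open>s\<close> leaves only an arbitrarily small
  error.\<close>

lemma outer_unit_normal_tangent_le:
  assumes K: "closed K" and u: "outer_unit_normal K x u" and t: "tangent_within (frontier K) x t"
  shows "t \<bullet> u \<le> 0"
proof (rule field_le_epsilon)
  fix e :: real assume "0 < e"
  then obtain d where d: "d > 0" "\<forall>s. 0 < s \<and> s < d \<longrightarrow> (\<exists>y\<in>frontier K. norm (y - x - s *\<^sub>R t) \<le> e * s)"
    using t unfolding tangent_within_def by blast
  define s where "s = d / 2"
  have s: "0 < s" "s < d" using d by (auto simp: s_def)
  then obtain y where y: "y \<in> frontier K" "norm (y - x - s *\<^sub>R t) \<le> e * s" using d by blast
  have "y \<in> K" using y K frontier_subset_closed by blast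
  then have "(y - x) \<bullet> u \<le> 0" using u by (simp add: outer_unit_normal_def)
  moreover have "s * (t \<bullet> u) = (y - x) \<bullet> u - (y - x - s *\<^sub>R t) \<bullet> u"
    by (simp add: inner_diff_left)
  moreover have "\<bar>(y - x - s *\<^sub>R t) \<bullet> u\<bar> \<le> norm (y - x - s *\<^sub>R t) * norm u"
    by (rule Cauchy_Schwarz_ineq2)
  moreover have "norm u = 1" using u by (simp add: outer_unit_normal_def)
  ultimately have "s * (t \<bullet> u) \<le> s * e" using y by (simp add: mult.commute)
  then show "t \<bullet> u \<le> 0 + e" using s by simp
qed

text \<open>Separation of \<open>x\<close> from the interior, extended to \<open>K\<close> by
  closure. It yields supporting normals at boundary points and, with \<open>x = 0\<close>, the
  half-space used for the centroid.\<close>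

lemma convex_body_nonneg_functional:
  fixes K :: "(real ^ 'n) set"
  assumes K: "convex_body K" and x: "x \<notin> interior K"
  obtains a where "a \<noteq> 0" "\<And>y. y \<in> K \<Longrightarrow> 0 \<le> a \<bullet> (y - x)"
proof -
  have "convex ((\<lambda>y. - x + y) ` interior K)"
    using K by (intro convex_translation convex_interior) (simp add: convex_body_def)
  moreover have "0 \<notin> (\<lambda>y. - x + y) ` interior K" using x by (auto simp: add_eq_0_iff)
  ultimately obtain a where a: "a \<noteq> 0" "\<forall>z\<in>(\<lambda>y. - x + y) ` interior K. 0 \<le> a \<bullet> z"
    using separating_hyperplane_set_0 by blast
  have "closed {y. 0 \<le> a \<bullet> (y - x)}" by (intro closed_Collect_le continuous_intros)
  moreover have "interior K \<subseteq> {y. 0 \<le> a \<bullet> (y - x)}" using a by auto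
  ultimately have "closure (interior K) \<subseteq> {y. 0 \<le> a \<bullet> (y - x)}" by (rule closure_minimal[rotated])
  moreover have "closure (interior K) = K"
    using K by (simp add: convex_body_def convex_closure_interior compact_imp_closed)
  ultimately show ?thesis using a that by blast
qed

lemma outer_unit_normal_exists:
  fixes K :: "(real ^ 'n) set"
  assumes "convex_body K" "x \<in> frontier K"
  shows "\<exists>u. outer_unit_normal K x u"
proof -
  obtain a where a: "a \<noteq> 0" "\<And>y. y \<in> K \<Longrightarrow> 0 \<le> a \<bullet> (y - x)"
    using convex_body_nonneg_functional[of K x] assms by (auto simp: frontier_def)
  have "(y - x) \<bullet> (- sgn a) \<le> 0" if "y \<in> K" for y
    using a(2)[OF that] by (simp add: sgn_div_norm inner_commute divide_nonneg_nonneg)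
  then have "outer_unit_normal K x (- sgn a)"
    using a assms by (simp add: outer_unit_normal_def norm_sgn)
  then show ?thesis ..
qed

text \<open>Two opposite normals would squeeze \<open>K\<close> into a hyperplane, which has empty
  interior.\<close>

lemma outer_unit_normal_not_opposite:
  fixes K :: "(real ^ 'n) set"
  assumes K: "convex_body K" and u: "outer_unit_normal K x u" and v: "outer_unit_normal K x (- u)"
  shows False
proof -
  have "K \<subseteq> {y. u \<bullet> y = u \<bullet> x}"
  proof
    fix y assume "y \<in> K"
    then have "(y - x) \<bullet> u \<le> 0" "(y - x) \<bullet> (- u) \<le> 0" using u v unfolding outer_unit_normal_def by blast+
    then show "y \<in> {y. u \<bullet> y = u \<bullet> x}" by (simp add: inner_diff_left inner_diff_right inner_commute)
  qed
  moreover have "u \<noteq> 0" using u by (auto simp: outer_unit_normal_def)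
  ultimately have "interior K \<subseteq> {}" using interior_mono interior_hyperplane by metis
  then show False using K by (simp add: convex_body_def)
qed

text \<open>The component \<open>w\<close> of \<open>u\<close> orthogonal to \<open>c\<close> is
  tangent together with \<open>- w\<close>, so \<open>w \<bullet> u = 0\<close> and hence
  \<open>w = 0\<close>. The sign stays open, since \<open>c\<close> will be the gradient of a
  defining function of unknown orientation.\<close>

lemma outer_unit_normal_eq_sgn:
  fixes K :: "(real ^ 'n) set"
  assumes K: "closed K" and u: "outer_unit_normal K x u" and c: "c \<noteq> 0"
    and t: "\<And>t. c \<bullet> t = 0 \<Longrightarrow> tangent_within (frontier K) x t"
  shows "u = sgn c \<or> u = - sgn c"
proof -
  define k where "k = (c \<bullet> u) / (c \<bullet> c)"
  define w where "w = u - k *\<^sub>R c"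
  have cw: "c \<bullet> w = 0" using c by (simp add: w_def k_def inner_diff_right)
  have "w \<bullet> u \<le> 0" using outer_unit_normal_tangent_le[OF K u t[OF cw]] .
  moreover have "(- w) \<bullet> u \<le> 0" using cw by (intro outer_unit_normal_tangent_le[OF K u t]) simp
  ultimately have "w \<bullet> u = 0" by simp
  then have "w \<bullet> w = 0" using cw by (simp add: w_def inner_diff_right inner_commute)
  then have uk: "u = k *\<^sub>R c" by (simp add: w_def)
  then have "\<bar>k\<bar> * norm c = 1" using u by (simp add: outer_unit_normal_def)
  then have "k = 1 / norm c \<or> k = - (1 / norm c)" using c by (auto simp: field_simps abs_if split: if_splits)
  then show ?thesis using uk by (auto simp: sgn_div_norm inverse_eq_divide)
qed

lemma C2_hypersurface_tangent_within:
  fixes S :: "(real ^ 'n) set"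
  assumes S: "C2_hypersurface S" and x: "x \<in> S"
  obtains U G H where "open U" "x \<in> U"
    "\<And>y. y \<in> U \<Longrightarrow> (G has_derivative (\<lambda>v. H y *v v)) (at y)"
    "continuous_on U (H :: real ^ 'n \<Rightarrow> real ^ 'n ^ 'n)"
    "\<And>y. y \<in> U \<Longrightarrow> G y \<noteq> 0"
    "\<And>y t. y \<in> U \<inter> S \<Longrightarrow> G y \<bullet> t = 0 \<Longrightarrow> tangent_within S y t"
proof -
  obtain U g where U: "open U" "x \<in> U" "C2_on U g"
    "\<forall>y\<in>U. \<not> (g has_derivative (\<lambda>v. 0)) (at y)" "S \<inter> U = {y \<in> U. g y = 0}"
    using S x unfolding C2_hypersurface_def by meson
  obtain G and H :: "real ^ 'n \<Rightarrow> real ^ 'n ^ 'n"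
    where G: "\<forall>y\<in>U. (g has_derivative (\<lambda>v. G y \<bullet> v)) (at y)"
      and H: "\<forall>y\<in>U. (G has_derivative (\<lambda>v. H y *v v)) (at y)" "continuous_on U H"
    using U(3) unfolding C2_on_def by blast
  have cont: "continuous_on U g"
    using G by (meson continuous_at_imp_continuous_on has_derivative_continuous)
  have nz: "G y \<noteq> 0" if "y \<in> U" for y
  proof
    assume "G y = 0"
    with G U(4) that show False by fastforce
  qed
  have "tangent_within S y t" if "y \<in> U \<inter> S" "G y \<bullet> t = 0" for y t
  proof -
    have "y \<in> U" "g y = 0" using that U(5) by auto
    then have "tangent_within {y \<in> U. g y = 0} y t"
      using tangent_within_level_set[OF U(1) _ cont _ _ nz that(2)] G by blast
    then show ?thesis
      by (rule tangent_within_subset) (use U(5) in blast)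
  qed
  with that[of U G H] U G H nz show thesis by blast
qed

lemma outer_unit_normal_unique:
  fixes K :: "(real ^ 'n) set"
  assumes K: "convex_body K" "C2_hypersurface (frontier K)"
    and u: "outer_unit_normal K x u" and v: "outer_unit_normal K x v"
  shows "u = v"
proof -
  have x: "x \<in> frontier K" using u by (simp add: outer_unit_normal_def)
  have cl: "closed K" using K by (simp add: convex_body_def compact_imp_closed)
  obtain U G and H :: "real ^ 'n \<Rightarrow> real ^ 'n ^ 'n"
    where "x \<in> U" and nz: "\<And>y. y \<in> U \<Longrightarrow> G y \<noteq> 0"
    and t: "\<And>y t. y \<in> U \<inter> frontier K \<Longrightarrow> G y \<bullet> t = 0 \<Longrightarrow> tangent_within (frontier K) y t"
    using C2_hypersurface_tangent_within[OF K(2) x] by metis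
  then have eq: "w = sgn (G x) \<or> w = - sgn (G x)" if "outer_unit_normal K x w" for w
    using x by (intro outer_unit_normal_eq_sgn[OF cl that]) auto
  show ?thesis
  proof (rule ccontr)
    assume "u \<noteq> v"
    then have "v = - u" using eq[OF u] eq[OF v] by auto
    then show False using outer_unit_normal_not_opposite[OF K(1) u] v by simp
  qed
qed

lemma outer_unit_normal_gauss_map:
  fixes K :: "(real ^ 'n) set"
  assumes "convex_body K" "C2_hypersurface (frontier K)" "x \<in> frontier K"
  shows "outer_unit_normal K x (gauss_map K x)"
  unfolding gauss_map_def
  using outer_unit_normal_exists[OF assms(1,3)] outer_unit_normal_unique[OF assms(1,2)]
  by (metis theI')

lemma gauss_map_eq:
  fixes K :: "(real ^ 'n) set"
  assumes "convex_body K" "C2_hypersurface (frontier K)" "outer_unit_normal K x u"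
  shows "gauss_map K x = u"
  using assms outer_unit_normal_gauss_map outer_unit_normal_unique outer_unit_normal_def by metis

text \<open>The graph of the Gauss map, and up to swapping coordinates that of its inverse;
  closedness here drives both continuity proofs.\<close>

lemma closed_outer_unit_normal:
  fixes K :: "(real ^ 'n) set"
  shows "closed {z. outer_unit_normal K (fst z) (snd z)}"
proof -
  have "{z. outer_unit_normal K (fst z) (snd z)} =
    (frontier K \<times> sphere 0 1) \<inter> (\<Inter>y\<in>K. {z. (y - fst z) \<bullet> snd z \<le> 0})"
    by (auto simp: outer_unit_normal_def)
  moreover have "closed \<dots>"
    by (intro closed_Int closed_Times closed_INT ballI closed_Collect_le continuous_intros) auto
  ultimately show ?thesis by simp
qed

lemma continuous_on_gauss_map:
  fixes K :: "(real ^ 'n) set"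
  assumes K: "convex_body K" "C2_hypersurface (frontier K)"
  shows "continuous_on (frontier K) (gauss_map K)"
proof (rule continuous_from_closed_graph[of "sphere 0 1"])
  show "gauss_map K \<in> frontier K \<rightarrow> sphere 0 1"
    using outer_unit_normal_gauss_map[OF K] by (auto simp: outer_unit_normal_def)
  have "Pair x (gauss_map K x) \<in> {z. outer_unit_normal K (fst z) (snd z)}" if "x \<in> frontier K" for x
    using outer_unit_normal_gauss_map[OF K that] by simp
  moreover have "z \<in> (\<lambda>x. Pair x (gauss_map K x)) ` frontier K" if "outer_unit_normal K (fst z) (snd z)" for z
    using gauss_map_eq[OF K that] that
    by (intro image_eqI[of _ _ "fst z"]) (auto simp: outer_unit_normal_def prod_eq_iff)
  ultimately have "(\<lambda>x. Pair x (gauss_map K x)) ` frontier K = {z. outer_unit_normal K (fst z) (snd z)}"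
    by blast
  then show "closed ((\<lambda>x. Pair x (gauss_map K x)) ` frontier K)"
    by (simp add: closed_outer_unit_normal)
qed auto

section \<open>Continuity of the curvature\<close>

text \<open>Near \<open>x\<close> the normal is plus or minus the normalised gradient. Continuity of
  the Gauss map keeps the sign constant, so it can be absorbed into \<open>G\<close> and
  \<open>H\<close>.\<close>

lemma gauss_map_local_sgn:
  fixes K :: "(real ^ 'n) set"
  assumes K: "convex_body K" "C2_hypersurface (frontier K)" and x: "x \<in> frontier K"
  obtains U G H where "open U" "x \<in> U"
    "\<And>y. y \<in> U \<Longrightarrow> (G has_derivative (\<lambda>v. H y *v v)) (at y)"
    "continuous_on U (H :: real ^ 'n \<Rightarrow> real ^ 'n ^ 'n)"
    "\<And>y. y \<in> U \<Longrightarrow> G y \<noteq> 0"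
    "\<And>y. y \<in> U \<inter> frontier K \<Longrightarrow> gauss_map K y = sgn (G y)"
    "\<And>y t. y \<in> U \<inter> frontier K \<Longrightarrow> G y \<bullet> t = 0 \<Longrightarrow> tangent_within (frontier K) y t"
proof -
  obtain U G and H :: "real ^ 'n \<Rightarrow> real ^ 'n ^ 'n" where U: "open U" "x \<in> U"
    and G: "\<And>y. y \<in> U \<Longrightarrow> (G has_derivative (\<lambda>v. H y *v v)) (at y)"
    and H: "continuous_on U H"
    and nz: "\<And>y. y \<in> U \<Longrightarrow> G y \<noteq> 0"
    and t: "\<And>y t. y \<in> U \<inter> frontier K \<Longrightarrow> G y \<bullet> t = 0 \<Longrightarrow> tangent_within (frontier K) y t"
    using C2_hypersurface_tangent_within[OF K(2) x] by metis
  define N where "N = gauss_map K"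
  have cl: "closed K" using K by (simp add: convex_body_def compact_imp_closed)
  have eq: "N y = sgn (G y) \<or> N y = - sgn (G y)" if "y \<in> U \<inter> frontier K" for y
    using that outer_unit_normal_eq_sgn[OF cl outer_unit_normal_gauss_map[OF K] nz t] by (simp add: N_def)
  define k where "k = sgn (N x \<bullet> G x)"
  have sg: "sgn c \<bullet> c = norm c" for c :: "real ^ 'n"
    by (cases "c = 0") (simp_all add: sgn_div_norm dot_square_norm power2_eq_square)
  have nx: "N x \<bullet> G x \<noteq> 0" using eq[of x] nz[of x] U x by (auto simp: sg)
  then have k: "k = 1 \<or> k = -1" by (auto simp: k_def sgn_if)
  have contG: "continuous_on U G"
    using G by (meson continuous_at_imp_continuous_on has_derivative_continuous)
  \<comment> \<open>This quantity is positive at \<open>x\<close> and so remains positive nearby,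
    which excludes a flip of the sign.\<close>
  have "((\<lambda>y. k * (N y \<bullet> G y)) \<longlongrightarrow> k * (N x \<bullet> G x)) (at x within frontier K)"
  proof (intro tendsto_intros)
    show "(N \<longlongrightarrow> N x) (at x within frontier K)"
      using continuous_on_gauss_map[OF K] x by (simp add: continuous_on_def N_def)
    show "(G \<longlongrightarrow> G x) (at x within frontier K)"
      using contG U continuous_at_imp_continuous_at_within[of x G "frontier K"]
      by (simp add: continuous_on_eq_continuous_at continuous_within)
  qed
  moreover have "0 < k * (N x \<bullet> G x)" using nx by (auto simp: k_def sgn_if)
  ultimately have "\<forall>\<^sub>F y in at x within frontier K. 0 < k * (N y \<bullet> G y)" by (rule order_tendstoD)
  then obtain V where V: "open V" "x \<in> V" "\<And>y. y \<in> V \<Longrightarrow> y \<noteq> x \<Longrightarrow> y \<in> frontier K \<Longrightarrow> 0 < k * (N y \<bullet> G y)"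
    unfolding eventually_at_topological by blast
  have pos: "0 < k * (N y \<bullet> G y)" if "y \<in> V" "y \<in> frontier K" for y
    using V(3) that \<open>0 < k * (N x \<bullet> G x)\<close> by (cases "y = x") auto
  show thesis
  proof (rule that[of "U \<inter> V" "\<lambda>y. k *\<^sub>R G y" "\<lambda>y. k *\<^sub>R H y"])
    show "((\<lambda>y. k *\<^sub>R G y) has_derivative (\<lambda>v. k *\<^sub>R H y *v v)) (at y)" if "y \<in> U \<inter> V" for y
      using that by (auto intro!: derivative_eq_intros G simp: scaleR_matrix_vector_assoc)
    show "gauss_map K y = sgn (k *\<^sub>R G y)" if y: "y \<in> U \<inter> V \<inter> frontier K" for y
    proof -
      have "N y = sgn (G y) \<or> N y = - sgn (G y)" "0 < k * (N y \<bullet> G y)" using eq pos y by auto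
      then show ?thesis using k nz[of y] y by (auto simp: N_def[symmetric] sg sgn_minus)
    qed
    show "tangent_within (frontier K) y t" if "y \<in> U \<inter> V \<inter> frontier K" "k *\<^sub>R G y \<bullet> t = 0" for y t
      using t[of y t] that k by auto
  qed (use U V H k nz in \<open>auto intro!: continuous_intros intro: continuous_on_subset\<close>)
qed

text \<open>Normalising removes the radial part of the derivative and divides the rest by the
  length.\<close>

lemma has_derivative_sgn_compose:
  fixes G :: "'a::real_normed_vector \<Rightarrow> 'b::real_inner"
  assumes G: "(G has_derivative G') (at x within S)" and nz: "G x \<noteq> 0"
  shows "((\<lambda>y. sgn (G y)) has_derivative
    (\<lambda>v. (G' v - (sgn (G x) \<bullet> G' v) *\<^sub>R sgn (G x)) /\<^sub>R norm (G x))) (at x within S)"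
proof -
  have "((\<lambda>y. norm (G y)) has_derivative (\<lambda>v. sgn (G x) \<bullet> G' v)) (at x within S)"
    using has_derivative_compose[OF G has_derivative_norm[OF nz]] by (simp add: inner_commute)
  from has_derivative_scaleR[OF Deriv.has_derivative_inverse[OF _ this] G] nz
  have "((\<lambda>y. inverse (norm (G y)) *\<^sub>R G y) has_derivative
     (\<lambda>v. inverse (norm (G x)) *\<^sub>R G' v +
        (- (inverse (norm (G x)) * (sgn (G x) \<bullet> G' v) * inverse (norm (G x)))) *\<^sub>R G x)) (at x within S)"
    by simp
  then show ?thesis
    by (simp add: sgn_div_norm scaleR_diff_right mult_ac)
qed

text \<open>\<open>frechet_derivative\<close> selects some derivative within the boundary. The
  curvature applies it only to vectors projected onto the tangent space, where all derivatives
  agree, so any known \<open>D\<close> computes it.\<close>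

lemma gauss_curvature_eq:
  fixes K :: "(real ^ 'n) set"
  assumes D: "(gauss_map K has_derivative D) (at x within frontier K)"
    and u: "gauss_map K x = u" "norm u = 1"
    and t: "\<And>t. u \<bullet> t = 0 \<Longrightarrow> tangent_within (frontier K) x t"
  shows "gauss_curvature K x = det (matrix (\<lambda>v. D (v - (v \<bullet> u) *\<^sub>R u) + (v \<bullet> u) *\<^sub>R u))"
proof -
  let ?W = "frechet_derivative (gauss_map K) (at x within frontier K)"
  have W: "(gauss_map K has_derivative ?W) (at x within frontier K)"
    using D frechet_derivative_works differentiableI by blast
  have "u \<bullet> (v - (v \<bullet> u) *\<^sub>R u) = 0" for v
    using u by (simp add: inner_diff_right dot_square_norm inner_commute)
  then have "?W (v - (v \<bullet> u) *\<^sub>R u) = D (v - (v \<bullet> u) *\<^sub>R u)" for v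
    by (intro has_derivative_unique_tangent[OF W D] t)
  then show ?thesis by (simp add: gauss_curvature_def u Let_def)
qed

lemma continuous_on_det:
  fixes A :: "'a::topological_space \<Rightarrow> real ^ 'n ^ 'n"
  assumes "continuous_on S A"
  shows "continuous_on S (\<lambda>x. det (A x))"
  unfolding det_def
  by (intro continuous_intros) (use assms in auto)

text \<open>The differential of the Gauss map is expressed on a whole neighbourhood through the
  continuous data \<open>G\<close> and \<open>H\<close>, so that it can be followed as the point
  \<open>y\<close> varies.\<close>

lemma gauss_map_curvature_local:
  fixes K :: "(real ^ 'n) set"
  assumes K: "convex_body K" "C2_hypersurface (frontier K)" and x: "x \<in> frontier K"
  obtains U G H where "open U" "x \<in> U"
    "continuous_on U (G :: real ^ 'n \<Rightarrow> real ^ 'n)" "continuous_on U (H :: real ^ 'n \<Rightarrow> real ^ 'n ^ 'n)"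
    "\<And>y. y \<in> U \<Longrightarrow> G y \<noteq> 0"
    "\<And>y. y \<in> U \<inter> frontier K \<Longrightarrow> (gauss_map K has_derivative
       (\<lambda>v. (H y *v v - (sgn (G y) \<bullet> (H y *v v)) *\<^sub>R sgn (G y)) /\<^sub>R norm (G y))) (at y within frontier K)"
    "\<And>y. y \<in> U \<inter> frontier K \<Longrightarrow> gauss_map K y = sgn (G y)"
    "\<And>y t. y \<in> U \<inter> frontier K \<Longrightarrow> sgn (G y) \<bullet> t = 0 \<Longrightarrow> tangent_within (frontier K) y t"
proof -
  obtain U G and H :: "real ^ 'n \<Rightarrow> real ^ 'n ^ 'n" where U: "open U" "x \<in> U"
    and G: "\<And>y. y \<in> U \<Longrightarrow> (G has_derivative (\<lambda>v. H y *v v)) (at y)"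
    and H: "continuous_on U H"
    and nz: "\<And>y. y \<in> U \<Longrightarrow> G y \<noteq> 0"
    and N: "\<And>y. y \<in> U \<inter> frontier K \<Longrightarrow> gauss_map K y = sgn (G y)"
    and t: "\<And>y t. y \<in> U \<inter> frontier K \<Longrightarrow> G y \<bullet> t = 0 \<Longrightarrow> tangent_within (frontier K) y t"
    using gauss_map_local_sgn[OF K x] by metis
  have contG: "continuous_on U G"
    using G by (meson continuous_at_imp_continuous_on has_derivative_continuous)
  have D: "(gauss_map K has_derivative
       (\<lambda>v. (H y *v v - (sgn (G y) \<bullet> (H y *v v)) *\<^sub>R sgn (G y)) /\<^sub>R norm (G y))) (at y within frontier K)"
    if y: "y \<in> U \<inter> frontier K" for y
  proof -
    have "(G has_derivative (\<lambda>v. H y *v v)) (at y within frontier K)"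
      using G y by (auto intro: has_derivative_at_withinI)
    from has_derivative_sgn_compose[OF this] nz y
    have *: "((\<lambda>y. sgn (G y)) has_derivative
       (\<lambda>v. (H y *v v - (sgn (G y) \<bullet> (H y *v v)) *\<^sub>R sgn (G y)) /\<^sub>R norm (G y))) (at y within frontier K)"
      by blast
    obtain d where d: "0 < d" "ball y d \<subseteq> U" using U(1) y openE by blast
    show ?thesis
      by (rule has_derivative_transform_within[OF * d(1)])
        (use y N d(2) in \<open>auto simp: dist_commute subset_iff\<close>)
  qed
  have tt: "tangent_within (frontier K) y t" if "y \<in> U \<inter> frontier K" "sgn (G y) \<bullet> t = 0" for y t
  proof (rule t[OF that(1)])
    show "G y \<bullet> t = 0" using that nz[of y] by (simp add: sgn_div_norm)
  qed
  show thesis by (rule that[OF U contG H nz D N tt])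
qed

lemma continuous_on_gauss_curvature:
  fixes K :: "(real ^ 'n) set"
  assumes K: "convex_body K" "C2_hypersurface (frontier K)"
  shows "continuous_on (frontier K) (gauss_curvature K)"
  unfolding continuous_on_eq_continuous_within
proof
  fix x assume x: "x \<in> frontier K"
  obtain U G and H :: "real ^ 'n \<Rightarrow> real ^ 'n ^ 'n" where U: "open U" "x \<in> U"
    and G: "continuous_on U G" and H: "continuous_on U H" and nz: "\<And>y. y \<in> U \<Longrightarrow> G y \<noteq> 0"
    and D: "\<And>y. y \<in> U \<inter> frontier K \<Longrightarrow> (gauss_map K has_derivative
       (\<lambda>v. (H y *v v - (sgn (G y) \<bullet> (H y *v v)) *\<^sub>R sgn (G y)) /\<^sub>R norm (G y))) (at y within frontier K)"
    and N: "\<And>y. y \<in> U \<inter> frontier K \<Longrightarrow> gauss_map K y = sgn (G y)"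
    and t: "\<And>y t. y \<in> U \<inter> frontier K \<Longrightarrow> sgn (G y) \<bullet> t = 0 \<Longrightarrow> tangent_within (frontier K) y t"
    by (rule gauss_map_curvature_local[OF K x]) (rule that; assumption)
  \<comment> \<open>The curvature formula with the explicit differential inserted. It makes sense on
    all of \<open>U\<close>, also off the boundary, and is visibly continuous there.\<close>
  define F where "F y = det (matrix (\<lambda>v.
      (H y *v (v - (v \<bullet> sgn (G y)) *\<^sub>R sgn (G y)) -
         (sgn (G y) \<bullet> (H y *v (v - (v \<bullet> sgn (G y)) *\<^sub>R sgn (G y)))) *\<^sub>R sgn (G y)) /\<^sub>R norm (G y)
      + (v \<bullet> sgn (G y)) *\<^sub>R sgn (G y)))" for y
  have F: "gauss_curvature K y = F y" if y: "y \<in> U \<inter> frontier K" for y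
    unfolding F_def
    by (rule gauss_curvature_eq[OF D[OF y] N[OF y] _ t[OF y]]) (use nz y in \<open>auto simp: norm_sgn\<close>)
  have mv: "continuous_on U (\<lambda>y. H y *v w y)" if "continuous_on U w" for w
    unfolding matrix_vector_mult_def
    by (intro continuous_intros H that)
  have sgnc: "continuous_on U (\<lambda>y. sgn (G y))"
    unfolding sgn_div_norm by (intro continuous_intros G) (use nz in auto)
  have "continuous_on U F"
    unfolding F_def matrix_def
    by (intro continuous_on_det continuous_intros mv G sgnc) (use nz in auto)
  then have "continuous_on (U \<inter> frontier K) F" by (rule continuous_on_subset) auto
  then have "continuous_on (U \<inter> frontier K) (gauss_curvature K)"
    using F by (metis (no_types, lifting) continuous_on_eq)
  then have "continuous (at x within (U \<inter> frontier K)) (gauss_curvature K)"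
    using U x by (simp add: continuous_on_eq_continuous_within)
  moreover have "at x within (U \<inter> frontier K) = at x within frontier K"
    by (rule at_within_nhd[OF U(2,1)]) auto
  ultimately show "continuous (at x within frontier K) (gauss_curvature K)" by simp
qed

section \<open>The inverse of the Gauss map\<close>

text \<open>Both endpoints maximise the inner product with \<open>u\<close> over \<open>K\<close>,
  hence so does every point between them; a maximiser is not interior, as a small step along
  \<open>u\<close> would increase the value.\<close>

lemma outer_unit_normal_segment:
  fixes K :: "(real ^ 'n) set"
  assumes K: "closed K" "convex K" and x: "outer_unit_normal K x u" and y: "outer_unit_normal K y u"
    and z: "z \<in> closed_segment x y"
  shows "outer_unit_normal K z u"
proof -
  have xy: "x \<in> K" "y \<in> K" using x y K frontier_subset_closed by (auto simp: outer_unit_normal_def)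
  then have zK: "z \<in> K" using z closed_segment_subset[OF _ _ K(2)] by blast
  have le: "w \<bullet> u \<le> x \<bullet> u" "w \<bullet> u \<le> y \<bullet> u" if "w \<in> K" for w
    using x y that by (auto simp: outer_unit_normal_def inner_diff_left)
  then have "x \<bullet> u = y \<bullet> u" using xy by (intro antisym) auto
  then have zu: "z \<bullet> u = x \<bullet> u" using z by (auto simp: in_segment inner_add_left) (simp add: algebra_simps)
  have u: "norm u = 1" using x by (simp add: outer_unit_normal_def)
  have "z \<notin> interior K"
  proof
    assume "z \<in> interior K"
    then obtain e where e: "e > 0" "cball z e \<subseteq> K" by (auto simp: mem_interior_cball)
    then have "z + e *\<^sub>R u \<in> K" using u by (auto simp: subset_iff dist_norm)
    then have "(z + e *\<^sub>R u) \<bullet> u \<le> x \<bullet> u" by (rule le)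
    then show False using zu e u by (simp add: inner_add_left dot_square_norm)
  qed
  then show ?thesis
    using zK zu le u K by (simp add: outer_unit_normal_def frontier_def inner_diff_left)
qed

text \<open>On a segment of points with a common normal the Gauss map is constant, so its differential
  is singular and the curvature vanishes.\<close>

lemma outer_unit_normal_point_unique:
  fixes K :: "(real ^ 'n) set"
  assumes K: "convex_body K" "C2_plus K"
    and x: "outer_unit_normal K x u" and y: "outer_unit_normal K y u"
  shows "x = y"
proof (rule ccontr)
  assume ne: "x \<noteq> y"
  have C2: "C2_hypersurface (frontier K)" using K by (simp add: C2_plus_def)
  have cK: "closed K" "convex K" using K by (auto simp: convex_body_def compact_imp_closed)
  have xf: "x \<in> frontier K" and u1: "norm u = 1" using x by (auto simp: outer_unit_normal_def)
  obtain U G and H :: "real ^ 'n \<Rightarrow> real ^ 'n ^ 'n" where U: "x \<in> U"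
    and D: "\<And>y. y \<in> U \<inter> frontier K \<Longrightarrow> (gauss_map K has_derivative
       (\<lambda>v. (H y *v v - (sgn (G y) \<bullet> (H y *v v)) *\<^sub>R sgn (G y)) /\<^sub>R norm (G y))) (at y within frontier K)"
    and N: "\<And>y. y \<in> U \<inter> frontier K \<Longrightarrow> gauss_map K y = sgn (G y)"
    and t: "\<And>y t. y \<in> U \<inter> frontier K \<Longrightarrow> sgn (G y) \<bullet> t = 0 \<Longrightarrow> tangent_within (frontier K) y t"
    by (rule gauss_map_curvature_local[OF K(1) C2 xf]) (rule that; assumption)
  define E where "E = (\<lambda>v. (H x *v v - (sgn (G x) \<bullet> (H x *v v)) *\<^sub>R sgn (G x)) /\<^sub>R norm (G x))"
  have E: "(gauss_map K has_derivative E) (at x within frontier K)"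
    unfolding E_def using D U xf by blast
  have Nx: "gauss_map K x = u" by (rule gauss_map_eq[OF K(1) C2 x])
  have curv: "gauss_curvature K x = det (matrix (\<lambda>v. E (v - (v \<bullet> u) *\<^sub>R u) + (v \<bullet> u) *\<^sub>R u))"
    by (rule gauss_curvature_eq[OF E Nx u1]) (use N[of x] t[of x] Nx U xf in auto)
  have seg: "outer_unit_normal K z u" if "z \<in> closed_segment x y" for z
    by (rule outer_unit_normal_segment[OF cK x y that])
  \<comment> \<open>\<open>E\<close> remains a derivative on the smaller set, where the Gauss map is
    constant and zero is another derivative. The two agree along \<open>y - x\<close>, which is
    tangent to the segment.\<close>
  have "(gauss_map K has_derivative E) (at x within closed_segment x y)"
    by (rule has_derivative_subset[OF E]) (use seg in \<open>auto simp: outer_unit_normal_def\<close>)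
  moreover have "(gauss_map K has_derivative (\<lambda>_. 0)) (at x within closed_segment x y)"
    by (rule has_derivative_transform[OF _ _ has_derivative_const[of u]])
      (use gauss_map_eq[OF K(1) C2 seg] in auto)
  ultimately have E0: "E (y - x) = 0"
    by (rule has_derivative_unique_tangent) (rule tangent_within_segment[OF order_refl])
  have "x \<in> K" "y \<in> K" using x y cK frontier_subset_closed by (auto simp: outer_unit_normal_def)
  then have yx: "(y - x) \<bullet> u = 0" using x y by (fastforce simp: outer_unit_normal_def inner_diff_left)
  have "linear E" using E has_derivative_bounded_linear bounded_linear.linear by blast
  then have "linear (\<lambda>v. E (v - (v \<bullet> u) *\<^sub>R u) + (v \<bullet> u) *\<^sub>R u)" (is "linear ?f")
    by (auto intro!: linearI simp: linear_add linear_diff linear_cmul algebra_simps inner_add_left)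
  moreover from this have "det (matrix ?f) \<noteq> 0 \<longleftrightarrow> inj ?f" by (rule det_nz_iff_inj)
  \<comment> \<open>The nonzero vector \<open>y - x\<close> is orthogonal to \<open>u\<close> and
    killed by \<open>E\<close>, so \<open>?f\<close> is not injective.\<close>
  moreover have "?f (y - x) = ?f 0" using E0 yx \<open>linear E\<close> by (simp add: linear_0)
  ultimately have "det (matrix ?f) = 0" using ne injD[of ?f "y - x" 0] by fastforce
  then show False using K(2) xf curv by (force simp: C2_plus_def)
qed

text \<open>Compactness gives a point of \<open>K\<close> farthest in direction
  \<open>u\<close>.\<close>

lemma outer_unit_normal_point_exists:
  fixes K :: "(real ^ 'n) set"
  assumes K: "convex_body K" and u: "norm u = 1"
  shows "\<exists>x. outer_unit_normal K x u"
proof -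
  have "compact K" "K \<noteq> {}" using K by (auto simp: convex_body_def)
  moreover have "continuous_on K (\<lambda>x. x \<bullet> u)" by (intro continuous_intros)
  ultimately obtain x where x: "x \<in> K" "\<And>y. y \<in> K \<Longrightarrow> y \<bullet> u \<le> x \<bullet> u"
    using continuous_attains_sup by metis
  have "x \<notin> interior K"
  proof
    assume "x \<in> interior K"
    then obtain e where e: "e > 0" "cball x e \<subseteq> K" by (auto simp: mem_interior_cball)
    then have "x + e *\<^sub>R u \<in> K" using u by (auto simp: subset_iff dist_norm)
    then have "(x + e *\<^sub>R u) \<bullet> u \<le> x \<bullet> u" by (rule x)
    then show False using e u by (simp add: inner_add_left dot_square_norm)
  qed
  then show ?thesis
    using x u closure_subset by (auto simp: outer_unit_normal_def frontier_def inner_diff_left intro!: exI[of _ x])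
qed

text \<open>The inverse Gauss map. The body is the description inside \<open>curvature_fun\<close>,
  which can therefore be folded to this name.\<close>

definition normal_point :: "(real ^ 'n) set \<Rightarrow> real ^ 'n \<Rightarrow> real ^ 'n" where
  "normal_point K u = (THE x. outer_unit_normal K x u)"

lemma outer_unit_normal_normal_point:
  fixes K :: "(real ^ 'n) set"
  assumes "convex_body K" "C2_plus K" "norm u = 1"
  shows "outer_unit_normal K (normal_point K u) u"
  unfolding normal_point_def
  using outer_unit_normal_point_exists[OF assms(1,3)] outer_unit_normal_point_unique[OF assms(1,2)]
  by (metis theI')

lemma continuous_on_normal_point:
  fixes K :: "(real ^ 'n) set"
  assumes K: "convex_body K" "C2_plus K"
  shows "continuous_on (sphere 0 1) (normal_point K)"
proof (rule continuous_from_closed_graph[of "frontier K"])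
  show "compact (frontier K)" using K by (auto simp: convex_body_def intro: compact_frontier)
  show "normal_point K \<in> sphere 0 1 \<rightarrow> frontier K"
    using outer_unit_normal_normal_point[OF K] by (auto simp: outer_unit_normal_def)
  have "(\<lambda>u. (u, normal_point K u)) ` sphere 0 1 = (\<lambda>z. (snd z, fst z)) -` {z. outer_unit_normal K (fst z) (snd z)}"
    using outer_unit_normal_normal_point[OF K] outer_unit_normal_point_unique[OF K]
    by (auto simp: image_iff outer_unit_normal_def)
  moreover have "closed \<dots>"
    by (intro continuous_closed_vimage closed_outer_unit_normal continuous_intros)
  ultimately show "closed ((\<lambda>u. (u, normal_point K u)) ` sphere 0 1)" by simp
qed

section \<open>Support and curvature functions on the sphere\<close>

lemma support_fun_eq:
  fixes K :: "(real ^ 'n) set"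
  assumes K: "closed K" and x: "outer_unit_normal K x u"
  shows "support_fun K u = x \<bullet> u"
proof -
  have "x \<in> K" using x K frontier_subset_closed by (auto simp: outer_unit_normal_def)
  then show ?thesis
    unfolding support_fun_def
    using x by (intro cSup_eq_maximum) (auto simp: outer_unit_normal_def inner_diff_left)
qed

text \<open>The supremum is attained at \<open>normal_point K u\<close>, which varies continuously
  with \<open>u\<close>.\<close>

lemma continuous_on_support_fun:
  fixes K :: "(real ^ 'n) set"
  assumes K: "convex_body K" "C2_plus K"
  shows "continuous_on (sphere 0 1) (support_fun K)"
proof -
  have "closed K" using K by (simp add: convex_body_def compact_imp_closed)
  then have "support_fun K u = normal_point K u \<bullet> u" if "u \<in> sphere 0 1" for u
    using that by (intro support_fun_eq outer_unit_normal_normal_point[OF K]) auto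
  moreover have "continuous_on (sphere 0 1) (\<lambda>u. normal_point K u \<bullet> u)"
    by (intro continuous_intros continuous_on_normal_point[OF K])
  ultimately show ?thesis by (metis (no_types, lifting) continuous_on_eq)
qed

lemma gauss_curvature_normal_point_pos:
  fixes K :: "(real ^ 'n) set"
  assumes K: "convex_body K" "C2_plus K" and u: "norm u = 1"
  shows "0 < gauss_curvature K (normal_point K u)"
  using outer_unit_normal_normal_point[OF assms] K by (simp add: C2_plus_def outer_unit_normal_def)

lemma curvature_fun_pos:
  fixes K :: "(real ^ 'n) set"
  assumes K: "convex_body K" "C2_plus K" and u: "norm u = 1"
  shows "0 < curvature_fun K u"
  using gauss_curvature_normal_point_pos[OF assms] by (simp add: curvature_fun_def normal_point_def)

lemma continuous_on_curvature_fun: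
  fixes K :: "(real ^ 'n) set"
  assumes K: "convex_body K" "C2_plus K"
  shows "continuous_on (sphere 0 1) (curvature_fun K)"
proof -
  have "continuous_on (sphere 0 1) (\<lambda>u. gauss_curvature K (normal_point K u))"
    by (rule continuous_on_compose2[OF continuous_on_gauss_curvature continuous_on_normal_point[OF K]])
      (use K outer_unit_normal_normal_point[OF K] in \<open>auto simp: C2_plus_def outer_unit_normal_def\<close>)
  then show ?thesis
    unfolding curvature_fun_def normal_point_def[symmetric]
    by (intro continuous_intros)
      (auto simp: gauss_curvature_normal_point_pos[OF K, THEN less_imp_neq, THEN not_sym])
qed

section \<open>Centroid and sphere measure\<close>

text \<open>Otherwise \<open>K\<close> lies in a half-space \<open>0 \<le> a \<bullet> y\<close>.
  The centroid condition makes the integral of \<open>a \<bullet> x\<close> over \<open>K\<close>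
  vanish, so this nonnegative function is zero almost everywhere on \<open>K\<close>, and the
  interior of \<open>K\<close> would be a null set.\<close>

lemma centroid_zero_interior:
  fixes K :: "(real ^ 'n) set"
  assumes K: "convex_body K" and c: "centroid K = 0"
  shows "0 \<in> interior K"
proof (rule ccontr)
  assume "0 \<notin> interior K"
  then obtain a where a: "a \<noteq> 0" "\<And>y. y \<in> K \<Longrightarrow> 0 \<le> a \<bullet> y"
    by (metis convex_body_nonneg_functional[OF K] diff_zero)
  have cK: "compact K" using K by (simp add: convex_body_def)
  have K_sets: "K \<in> sets lborel" using cK by (simp add: borel_compact)
  have sub: "interior K \<subseteq> K" by (rule interior_subset)
  have int: "interior K \<noteq> {}" using K by (simp add: convex_body_def)
  \<comment> \<open>If the volume were 0, the factor \<open>1 / measure lborel K\<close> would be 0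
    by convention, and \<open>centroid K = 0\<close> would say nothing about the integral.\<close>
  have "0 < measure lborel K"
  proof -
    have "\<not> negligible (interior K)" using int open_not_negligible by blast
    then have "\<not> negligible K" using sub negligible_subset by blast
    then have "measure lebesgue K \<noteq> 0"
      using cK lmeasurable_compact negligible_iff_measure0 by blast
    then show ?thesis using K_sets by (simp add: measure_completion zero_less_measure_iff)
  qed
  then have z: "(LINT x:K|lborel. x) = 0" using c by (simp add: centroid_def)
  have I: "set_integrable lborel K (\<lambda>x. x)"
    by (rule borel_integrable_compact[OF cK, of "\<lambda>x. x", unfolded set_integrable_def[symmetric]]) auto
  have I': "integrable lborel (\<lambda>x. indicator K x *\<^sub>R (a \<bullet> x))"
    using integrable_inner_right[of a lborel "\<lambda>x. indicator K x *\<^sub>R x"] I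
    by (simp add: set_integrable_def)
  have "(LINT x|lborel. indicator K x *\<^sub>R (a \<bullet> x)) = a \<bullet> (LINT x:K|lborel. x)"
    using integral_inner_right[of a lborel "\<lambda>x. indicator K x *\<^sub>R x"] I
    by (simp add: set_integrable_def set_lebesgue_integral_def)
  then have "(LINT x|lborel. indicator K x *\<^sub>R (a \<bullet> x)) = 0" using z by simp
  moreover have "(LINT x|lborel. indicator K x *\<^sub>R (a \<bullet> x)) = 0 \<longleftrightarrow> (AE x in lborel. indicator K x *\<^sub>R (a \<bullet> x) = 0)"
    by (rule integral_nonneg_eq_0_iff_AE[OF I']) (auto simp: indicator_def a)
  ultimately have "AE x in lborel. indicator K x *\<^sub>R (a \<bullet> x) = 0" by simp
  then have "AE x in lebesgue. indicator K x *\<^sub>R (a \<bullet> x) = 0" by (rule AE_completion)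
  then have "negligible {x. indicator K x *\<^sub>R (a \<bullet> x) \<noteq> 0}"
    by (simp add: eventually_ae_filter_negligible negligible_subset) (meson negligible_subset)
  moreover have "negligible {x. a \<bullet> x = 0}" using a by (simp add: negligible_hyperplane)
  ultimately have "negligible ({x. indicator K x *\<^sub>R (a \<bullet> x) \<noteq> 0} \<union> {x. a \<bullet> x = 0})"
    by (rule negligible_Un)
  then have "negligible (interior K)"
    by (rule negligible_subset) (use sub in \<open>auto simp: indicator_def\<close>)
  then show False using int open_not_negligible by blast
qed

lemma finite_measure_sphere_measure: "finite_measure (sphere_measure :: (real ^ 'n) measure)"
proof
  let ?A = "{x :: real ^ 'n. 0 < norm x \<and> norm x < 1 \<and> sgn x \<in> sphere 0 1}"
  have "emeasure lborel ?A \<le> emeasure lborel (ball 0 1 :: (real ^ 'n) set)"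
    by (rule emeasure_mono) auto
  also have "\<dots> < \<infinity>" using emeasure_bounded_finite[of "ball 0 1 :: (real ^ 'n) set"] by simp
  finally have "of_nat CARD('n) * emeasure lborel ?A < \<infinity>"
    by (simp add: ennreal_mult_less_top of_nat_less_top)
  then show "emeasure (sphere_measure :: (real ^ 'n) measure) (space sphere_measure) \<noteq> \<infinity>"
    using emeasure_sphere_measure[of "sphere 0 1 :: (real ^ 'n) set"]
    by (simp add: sets_sphere_measure sets_restrict_space_iff)
qed

text \<open>The cone over the whole sphere is the punctured unit ball, so the total mass is a
  positive multiple of the volume of the ball.\<close>

lemma measure_sphere_measure_pos: "0 < measure (sphere_measure :: (real ^ 'n) measure) (sphere 0 1)"
proof -
  interpret finite_measure "sphere_measure :: (real ^ 'n) measure" by (rule finite_measure_sphere_measure)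
  let ?A = "{x :: real ^ 'n. 0 < norm x \<and> norm x < 1 \<and> sgn x \<in> sphere 0 1}"
  have "?A = ball 0 1 - {0}" by (auto simp: norm_sgn)
  then have "emeasure lborel ?A = emeasure lborel (ball 0 1 - {0} :: (real ^ 'n) set)" by simp
  also have "\<dots> = emeasure lborel (ball 0 1 :: (real ^ 'n) set)"
    by (intro emeasure_Diff_null_set) (auto simp: null_sets_def)
  also have "\<dots> \<noteq> 0"
    using content_ball_pos[of 1 "0 :: real ^ 'n"] by (auto simp: measure_def)
  finally have "emeasure (sphere_measure :: (real ^ 'n) measure) (sphere 0 1) \<noteq> 0"
    using emeasure_sphere_measure[of "sphere 0 1 :: (real ^ 'n) set"]
    by (simp add: sets_sphere_measure sets_restrict_space_iff)
  then show ?thesis by (simp add: emeasure_eq_measure zero_less_measure_iff)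
qed

lemma integrable_sphere_measure:
  fixes f :: "real ^ 'n \<Rightarrow> real"
  assumes f: "continuous_on (sphere 0 1) f"
  shows "integrable sphere_measure f"
proof -
  interpret finite_measure "sphere_measure :: (real ^ 'n) measure" by (rule finite_measure_sphere_measure)
  have "compact (f ` sphere 0 1)" by (intro compact_continuous_image f) auto
  then obtain B where B: "\<And>u. norm u = 1 \<Longrightarrow> norm (f u) \<le> B"
    using compact_imp_bounded bounded_iff by (metis (no_types, lifting) dist_0_norm imageI mem_sphere)
  have "f \<in> borel_measurable sphere_measure"
    using borel_measurable_continuous_on_restrict[OF f] measurable_cong_sets[OF sets_sphere_measure refl] by blast
  then show ?thesis using B by (intro integrable_const_bound[of _ B] AE_I2) auto
qed

text \<open>The integral is at least the minimum of \<open>f\<close>, attained and positive on the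
  compact sphere, times the total mass.\<close>

lemma integral_sphere_measure_pos:
  fixes f :: "real ^ 'n \<Rightarrow> real"
  assumes f: "continuous_on (sphere 0 1) f" and pos: "\<And>u. norm u = 1 \<Longrightarrow> 0 < f u"
  shows "0 < (LINT u|sphere_measure. f u)"
proof -
  interpret finite_measure "sphere_measure :: (real ^ 'n) measure" by (rule finite_measure_sphere_measure)
  obtain v where v: "norm v = 1" "\<And>u. norm u = 1 \<Longrightarrow> f v \<le> f u"
    using continuous_attains_inf[OF _ _ f] by auto
  have "0 < f v * measure (sphere_measure :: (real ^ 'n) measure) (sphere 0 1)"
    by (intro mult_pos_pos pos v measure_sphere_measure_pos)
  also have "\<dots> = (LINT u|(sphere_measure :: (real ^ 'n) measure). f v)" by simp
  also have "\<dots> \<le> (LINT u|sphere_measure. f u)"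
    by (rule integral_mono) (use v in \<open>auto intro: integrable_sphere_measure f\<close>)
  finally show ?thesis .
qed

section \<open>The inequalities\<close>

theorem proposition2p5:
  fixes K :: "'n \<Rightarrow> (real ^ 'n) set" and p r :: real
  assumes "\<And>i. convex_body (K i)" and "\<And>i. C2_plus (K i)" and "\<And>i. centroid (K i) = 0"
  shows
    "((- real CARD('n) < r \<and> r < p) \<or> (r < p \<and> p < - real CARD('n)) \<longrightarrow>
        (mixed_affine_surface_area p K / (real CARD('n) * dual_mixed_volume (\<lambda>i. polar_body (K i))))
            powr (real CARD('n) + p)
        \<le> (mixed_affine_surface_area r K / (real CARD('n) * dual_mixed_volume (\<lambda>i. polar_body (K i))))
            powr (real CARD('n) + r)) \<and>
     ((0 < p \<and> p < r) \<or> (p < r \<and> r < - real CARD('n)) \<or> (r < - real CARD('n) \<and> 0 < p)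
        \<or> (- real CARD('n) < p \<and> p < r \<and> r < 0) \<longrightarrow>
        (mixed_affine_surface_area p K / mixed_affine_surface_area 0 K)
            powr ((real CARD('n) + p) / p)
        \<le> (mixed_affine_surface_area r K / mixed_affine_surface_area 0 K)
            powr ((real CARD('n) + r) / r))"
proof -
  define n where "n = real CARD('n)"
  have n: "n > 0" by (simp add: n_def)
  define h where "h u = (\<Prod>i\<in>UNIV. support_fun (K i) u)" for u
  define f where "f u = (\<Prod>i\<in>UNIV. curvature_fun (K i) u)" for u
  have interior: "0 \<in> interior (K i)" for i by (intro centroid_zero_interior assms)
  have compact: "compact (K i)" for i using assms(1)[of i] by (simp add: convex_body_def)
  have hi: "0 < support_fun (K i) u" if "norm u = 1" for i u
    by (rule support_fun_pos[OF compact interior that])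
  have h: "0 < h u" if "norm u = 1" for u unfolding h_def by (intro prod_pos hi that)
  have f: "0 < f u" if "norm u = 1" for u
    unfolding f_def by (intro prod_pos curvature_fun_pos assms that)
  have conth: "continuous_on (sphere 0 1) h"
    unfolding h_def by (intro continuous_intros continuous_on_support_fun assms)
  have contf: "continuous_on (sphere 0 1) f"
    unfolding f_def by (intro continuous_intros continuous_on_curvature_fun assms)
  have contp: "continuous_on (sphere 0 1) (\<lambda>u. h u powr a * f u powr b)" for a b
    by (intro continuous_intros conth contf) (use h f in force)+
  have as: "mixed_affine_surface_area q K
      = (LINT u|sphere_measure. h u powr ((1 - q) / (n + q)) * f u powr (1 / (n + q)))" for q
    unfolding mixed_affine_surface_area_def n_def[symmetric]
  proof (rule Bochner_Integration.integral_cong[OF refl])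
    fix u :: "real ^ 'n" assume "u \<in> space sphere_measure"
    then have u: "norm u = 1" by simp
    have "(\<Prod>i\<in>UNIV. support_fun (K i) u powr (1 - q) * curvature_fun (K i) u) = h u powr (1 - q) * f u"
      unfolding h_def f_def using hi[OF u] by (simp add: prod.distrib prod_powr_distrib less_imp_le)
    then show "(\<Prod>i\<in>UNIV. support_fun (K i) u powr (1 - q) * curvature_fun (K i) u) powr (1 / (n + q))
        = h u powr ((1 - q) / (n + q)) * f u powr (1 / (n + q))"
      using h[OF u] f[OF u] by (simp add: powr_mult powr_powr)
  qed
  \<comment> \<open>Written with exponents \<open>- 1\<close> and \<open>0\<close> to match the
    shape of the denominator in \<open>pm\<close>.\<close>
  have V: "n * dual_mixed_volume (\<lambda>i. polar_body (K i)) = (LINT u|sphere_measure. h u powr (- 1) * f u powr 0)"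
  proof -
    have "n * dual_mixed_volume (\<lambda>i. polar_body (K i)) = (LINT u|sphere_measure. 1 / h u)"
      using n by (simp add: dual_mixed_volume_polar compact interior n_def h_def)
    also have "\<dots> = (LINT u|sphere_measure. h u powr (- 1) * f u powr 0)"
      using h f by (intro Bochner_Integration.integral_cong refl)
        (auto simp: powr_minus_divide abs_of_pos dest: order.strict_implies_not_eq[OF f])
    finally show ?thesis .
  qed
  \<comment> \<open>Power means of \<open>h u powr \<gamma> * f u powr \<delta>\<close> for the
    weight \<open>h u powr \<alpha> * f u powr \<beta>\<close>. Multiplying out makes the exponents
    affine in \<open>a\<close> and \<open>b\<close>; both parts of the theorem are
    instances.\<close>
  have pm: "((LINT u|sphere_measure. h u powr (\<alpha> + \<gamma> * a) * f u powr (\<beta> + \<delta> * a))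
          / (LINT u|sphere_measure. h u powr \<alpha> * f u powr \<beta>)) powr (1 / a)
      \<le> ((LINT u|sphere_measure. h u powr (\<alpha> + \<gamma> * b) * f u powr (\<beta> + \<delta> * b))
          / (LINT u|sphere_measure. h u powr \<alpha> * f u powr \<beta>)) powr (1 / b)"
    if ab: "a \<le> b" "0 < a * b" for a b \<alpha> \<beta> \<gamma> \<delta>
  proof -
    let ?w = "\<lambda>u. h u powr \<alpha> * f u powr \<beta>" and ?g = "\<lambda>u. h u powr \<gamma> * f u powr \<delta>"
    have eq: "?w u * ?g u powr c = h u powr (\<alpha> + \<gamma> * c) * f u powr (\<beta> + \<delta> * c)"
      if "norm u = 1" for u c
      using h[OF that] f[OF that] by (simp add: powr_mult powr_powr powr_add mult_ac)
    have cont: "continuous_on (sphere 0 1) (\<lambda>u. ?w u * ?g u powr c)" for c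
      by (rule continuous_on_eq[OF contp[of "\<alpha> + \<gamma> * c" "\<beta> + \<delta> * c"]]) (simp add: eq)
    have int_eq: "(LINT u|sphere_measure. ?w u * ?g u powr c)
        = (LINT u|sphere_measure. h u powr (\<alpha> + \<gamma> * c) * f u powr (\<beta> + \<delta> * c))" for c
      by (rule Bochner_Integration.integral_cong) (simp_all add: eq)
    have wg: "0 < ?w u" "0 < ?g u" if "norm u = 1" for u
      using h[OF that] f[OF that] by simp_all
    have "((LINT u|sphere_measure. ?w u * ?g u powr a) / (LINT u|sphere_measure. ?w u)) powr (1 / a)
       \<le> ((LINT u|sphere_measure. ?w u * ?g u powr b) / (LINT u|sphere_measure. ?w u)) powr (1 / b)"
    proof (rule weighted_power_mean_mono[OF integrable_sphere_measure[OF cont] _ _ _ ab])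
      show "0 < (LINT u|sphere_measure. ?w u * ?g u powr c)" for c
      proof (rule integral_sphere_measure_pos[OF cont])
        show "0 < ?w u * ?g u powr c" if "norm u = 1" for u
          using h[OF that] f[OF that] by simp
      qed
    qed (use wg in auto)
    then show ?thesis unfolding int_eq .
  qed
  show ?thesis
    unfolding n_def[symmetric]
  proof (intro conjI impI)
    assume pr: "- n < r \<and> r < p \<or> r < p \<and> p < - n"
    then have nz: "n + p \<noteq> 0" "n + r \<noteq> 0" and pos: "0 < (n + p) * (n + r)"
      by (auto simp: zero_less_mult_iff)
    have as': "mixed_affine_surface_area q K
       = (LINT u|sphere_measure. h u powr (- 1 + (n + 1) * (1 / (n + q))) * f u powr (0 + 1 * (1 / (n + q))))"
      if "n + q \<noteq> 0" for q
    proof -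
      have "- 1 + (n + 1) * (1 / (n + q)) = (1 - q) / (n + q)" using that by (simp add: field_simps)
      then show ?thesis by (simp only: as mult_1 add_0)
    qed
    \<comment> \<open>Reciprocals reverse the order \<open>r < p\<close>, as \<open>n + p\<close>
      and \<open>n + r\<close> have the same sign in both cases.\<close>
    have le: "1 / (n + p) \<le> 1 / (n + r)" and "0 < (1 / (n + p)) * (1 / (n + r))"
      using pr pos by (auto simp: field_simps zero_less_mult_iff)
    from pm[OF this, where \<alpha>="- 1" and \<gamma>="n + 1" and \<beta>=0 and \<delta>=1]
    show "(mixed_affine_surface_area p K / (n * dual_mixed_volume (\<lambda>i. polar_body (K i)))) powr (n + p)
        \<le> (mixed_affine_surface_area r K / (n * dual_mixed_volume (\<lambda>i. polar_body (K i)))) powr (n + r)"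
      unfolding as'[OF nz(1), symmetric] as'[OF nz(2), symmetric] V by simp
  next
    assume pr: "0 < p \<and> p < r \<or> p < r \<and> r < - n \<or> r < - n \<and> 0 < p \<or> - n < p \<and> p < r \<and> r < 0"
    then have nz: "n + p \<noteq> 0" "n + r \<noteq> 0" "p \<noteq> 0" "r \<noteq> 0" using n by auto
    \<comment> \<open>Weight \<open>(h * f) powr (1 / n)\<close> and function
      \<open>g powr (- 1 / n)\<close> for \<open>g = h ^ (n + 1) * f\<close>, raised to the exponent
      \<open>q / (n + q)\<close>.\<close>
    have as': "mixed_affine_surface_area q K
       = (LINT u|sphere_measure. h u powr (1 / n + (- (n + 1) / n) * (q / (n + q)))
            * f u powr (1 / n + (- 1 / n) * (q / (n + q))))"
      if "n + q \<noteq> 0" for q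
    proof -
      have "1 / n + (- (n + 1) / n) * (q / (n + q)) = (1 - q) / (n + q)"
        "1 / n + (- 1 / n) * (q / (n + q)) = 1 / (n + q)"
        using that n by (simp_all add: divide_simps) (simp_all add: algebra_simps)
      then show ?thesis by (simp only: as)
    qed
    have as0: "mixed_affine_surface_area 0 K = (LINT u|sphere_measure. h u powr (1 / n) * f u powr (1 / n))"
      by (simp add: as)
    have diff: "r / (n + r) - p / (n + p) = n * (r - p) / ((n + r) * (n + p))"
      using nz by (simp add: divide_simps) (simp add: algebra_simps)
    \<comment> \<open>Only for \<open>r < - n\<close> and \<open>0 < p\<close> are both factors
      negative; in the other three cases both are positive.\<close>
    have "0 \<le> r - p \<and> 0 \<le> (n + r) * (n + p) \<or> r - p \<le> 0 \<and> (n + r) * (n + p) \<le> 0"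
      using pr n by (auto simp: zero_le_mult_iff mult_le_0_iff)
    then have "0 \<le> n * (r - p) / ((n + r) * (n + p))"
      using n by (auto simp: zero_le_divide_iff mult_le_0_iff)
    then have le: "p / (n + p) \<le> r / (n + r)" using diff by simp
    \<comment> \<open>The quotient \<open>q / (n + q)\<close> is negative exactly for
      \<open>q\<close> between \<open>- n\<close> and 0, and only the last case has \<open>p\<close>
      and \<open>r\<close> there.\<close>
    have "0 < p / (n + p) \<and> 0 < r / (n + r) \<or> p / (n + p) < 0 \<and> r / (n + r) < 0"
      using pr n by (auto simp: zero_less_divide_iff divide_less_0_iff)
    then have "0 < (p / (n + p)) * (r / (n + r))"
      unfolding zero_less_mult_iff .
    from pm[OF le this, where \<alpha>="1 / n" and \<gamma>="- (n + 1) / n" and \<beta>="1 / n" and \<delta>="- 1 / n"]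
    show "(mixed_affine_surface_area p K / mixed_affine_surface_area 0 K) powr ((n + p) / p)
        \<le> (mixed_affine_surface_area r K / mixed_affine_surface_area 0 K) powr ((n + r) / r)"
      unfolding as'[OF nz(1), symmetric] as'[OF nz(2), symmetric] as0 by simp
  qed
qed

end
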